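(* Let $S_\gamma\subset\mathbb{I}^3$ be a surface of parabolic revolution generated by $\gamma(t)=(t,0,z(t))$, that is, $$\mathbf r(t,\theta)=\left(a\theta+t,\;b\theta,\;c\theta+\frac{ac_1+bc_2}{2}\theta^2+c_1t\theta+z(t)\right),$$ with constants $a,b,c,c_1,c_2\in\mathbb{R}$, $b\neq0$, and suppose that $S_\gamma$ is an isotropic singular minimal surface. 1. If the reference plane is the isotropic plane $\Pi_{yz}=\{x=0\}$, then there are two cases: (a) if $a=0$, then $c_1=0$ and $$z(t)=-\frac{c_2}{4b}\,t^2+z_2\ln(t)+z_1,\quad z_1,z_2\in\mathbb{R};$$ (b) if $a\neq0$, then $ac_2+2bc_1=0$ and $$z(t)=\frac{c_1}{2a}\,t^2+z_1,\quad z_1\in\mathbb{R}.$$ 2. If the reference plane is the non-isotropic plane $\Pi_{xy}=\{z=0\}$, then $c=c_1=0$ and $z(t)$ is a solution of $$(2z+bc_2t^2)z''+z'^2-\frac{2abc_2}{a^2+b^2}\,tz'+\frac{2bc_2}{a^2+b^2}(z+bc_2t^2)-\frac{b^2}{a^2+b^2}=0.$$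
   Context: The simply isotropic space $\mathbb{I}^3$ is $\mathbb{R}^3$ with coordinates $(x,y,z)$ and the degenerate metric $\langle\mathbf u,\mathbf v\rangle=u^1v^1+u^2v^2$; the secondary metric is $\langle\langle\mathbf u,\mathbf v\rangle\rangle=u^3v^3$. An admissible surface (no tangent plane contains the direction $(0,0,1)$) is locally a graph $(x,y,u(x,y))$; its mean curvature is $H=\frac{u_{xx}+u_{yy}}{2}$ and its parabolic normal is $\mathbf N_{par}=\left(-u_x,-u_y,\frac12-\frac{u_x^2+u_y^2}{2}\right)$. An admissible surface $M^2$ is an isotropic singular minimal surface with respect to the reference plane $\Pi_{yz}=\{x=0\}$ if $H(p)=\frac{\langle\mathbf N_{par},\partial_x\rangle}{2\,d(p,\Pi_{yz})}$ for all $p\in M^2$, where surfaces are taken in the half-space $x>0$ and $d(p,\Pi_{yz})=x$; it is an isotropic singular minimal surface with respect to $\Pi_{xy}=\{z=0\}$ if $H(p)=\frac{\langle\langle\mathbf N_{par},\partial_z\rangle\rangle}{2\,d(p,\Pi_{xy})}$ for all $p\in M^2$, where surfaces are taken in the half-space $z>0$ and $d(p,\Pi_{xy})=z$ (distance in the secondary metric). Surfaces of parabolic revolution are those invariant under the one-parameter group $(x,y,z)\mapsto\left(x+a\theta,\;y+b\theta,\;z+c_1\theta x+c_2\theta y+c\theta+\frac{ac_1+bc_2}{2}\theta^2\right)$, $\theta\in\mathbb{R}$. *)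

theory Defs
  imports "HOL-Analysis.Analysis"
begin

type_synonym point3 = "real \<times> real \<times> real"

section \<open>The two metrics of simply isotropic space\<close>

fun iso_metric :: "point3 \<Rightarrow> point3 \<Rightarrow> real" where
  "iso_metric (u1, u2, u3) (v1, v2, v3) = u1 * v1 + u2 * v2"

fun iso_metric_secondary :: "point3 \<Rightarrow> point3 \<Rightarrow> real" where
  "iso_metric_secondary (u1, u2, u3) (v1, v2, v3) = u3 * v3"

section \<open>Partial derivatives and functions of class C2 on the plane\<close>

definition pd1 :: "(real \<times> real \<Rightarrow> 'a::real_normed_vector) \<Rightarrow> real \<times> real \<Rightarrow> 'a" where
  "pd1 f = (\<lambda>(x, y). vector_derivative (\<lambda>s. f (s, y)) (at x))"

definition pd2 :: "(real \<times> real \<Rightarrow> 'a::real_normed_vector) \<Rightarrow> real \<times> real \<Rightarrow> 'a" where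
  "pd2 f = (\<lambda>(x, y). vector_derivative (\<lambda>s. f (x, s)) (at y))"

definition C1_on :: "(real \<times> real) set \<Rightarrow> (real \<times> real \<Rightarrow> 'a::real_normed_vector) \<Rightarrow> bool" where
  "C1_on U f \<longleftrightarrow>
     (\<forall>(x, y)\<in>U. (\<lambda>s. f (s, y)) differentiable (at x) \<and> (\<lambda>s. f (x, s)) differentiable (at y)) \<and>
     continuous_on U (pd1 f) \<and> continuous_on U (pd2 f)"

definition C2_on :: "(real \<times> real) set \<Rightarrow> (real \<times> real \<Rightarrow> 'a::real_normed_vector) \<Rightarrow> bool" where
  "C2_on U f \<longleftrightarrow> C1_on U f \<and> C1_on U (pd1 f) \<and> C1_on U (pd2 f)"

section \<open>Admissible surfaces\<close>

definition regular_chart ::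
    "point3 set \<Rightarrow> (real \<times> real) set \<Rightarrow> (real \<times> real \<Rightarrow> point3) \<Rightarrow> bool" where
  "regular_chart S D X \<longleftrightarrow>
     open D \<and> (\<exists>Y. homeomorphism D S X Y) \<and> C2_on D X \<and>
     (\<forall>q\<in>D. pd1 X q \<noteq> pd2 X q \<and> independent {pd1 X q, pd2 X q})"

text \<open>The tangent plane at \<open>X q\<close> is the span of the two partial derivatives of the chart;
  it does not depend on the chart.\<close>

definition admissible_surface :: "point3 set \<Rightarrow> bool" where
  "admissible_surface M \<longleftrightarrow>
     (\<forall>p\<in>M. \<exists>V D X. open V \<and> p \<in> V \<and> regular_chart (M \<inter> V) D X \<and>
        (\<forall>q\<in>D. (0, 0, 1) \<notin> span {pd1 X q, pd2 X q}))"

definition local_graph :: "point3 set \<Rightarrow> point3 \<Rightarrow> (real \<times> real \<Rightarrow> real) \<Rightarrow> bool" where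
  "local_graph M p u \<longleftrightarrow>
     (\<exists>U V. open U \<and> open V \<and> p \<in> V \<and> C2_on U u \<and>
        M \<inter> V = {(x, y, u (x, y)) | x y. (x, y) \<in> U})"

text \<open>Around each of its points an admissible surface is the graph of a function, whose germ is
  unique; the derivatives at the base point of the function chosen here are therefore
  well defined.\<close>

definition graph_fun :: "point3 set \<Rightarrow> point3 \<Rightarrow> (real \<times> real \<Rightarrow> real)" where
  "graph_fun M p = (SOME u. local_graph M p u)"

fun base_point :: "point3 \<Rightarrow> real \<times> real" where
  "base_point (x, y, z) = (x, y)"

definition mean_curvature :: "point3 set \<Rightarrow> point3 \<Rightarrow> real" where
  "mean_curvature M p =
     (let u = graph_fun M p; q = base_point p
      in (pd1 (pd1 u) q + pd2 (pd2 u) q) / 2)"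

definition parabolic_normal :: "point3 set \<Rightarrow> point3 \<Rightarrow> point3" where
  "parabolic_normal M p =
     (let u = graph_fun M p; q = base_point p
      in (- pd1 u q, - pd2 u q, 1 / 2 - ((pd1 u q)\<^sup>2 + (pd2 u q)\<^sup>2) / 2))"

section \<open>Isotropic singular minimal surfaces\<close>

definition half_space_x :: "point3 set" where
  "half_space_x = {(x, y, z). x > 0}"

definition half_space_z :: "point3 set" where
  "half_space_z = {(x, y, z). z > 0}"

text \<open>Distances of points of the half-spaces \<open>x > 0\<close> and \<open>z > 0\<close> to the bounding planes.\<close>

fun dist_plane_yz :: "point3 \<Rightarrow> real" where
  "dist_plane_yz (x, y, z) = x"

fun dist_plane_xy :: "point3 \<Rightarrow> real" where
  "dist_plane_xy (x, y, z) = z"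

definition isotropic_singular_minimal_yz :: "point3 set \<Rightarrow> bool" where
  "isotropic_singular_minimal_yz M \<longleftrightarrow>
     admissible_surface M \<and> M \<subseteq> half_space_x \<and>
     (\<forall>p\<in>M. mean_curvature M p =
        iso_metric (parabolic_normal M p) (1, 0, 0) / (2 * dist_plane_yz p))"

definition isotropic_singular_minimal_xy :: "point3 set \<Rightarrow> bool" where
  "isotropic_singular_minimal_xy M \<longleftrightarrow>
     admissible_surface M \<and> M \<subseteq> half_space_z \<and>
     (\<forall>p\<in>M. mean_curvature M p =
        iso_metric_secondary (parabolic_normal M p) (0, 0, 1) / (2 * dist_plane_xy p))"

section \<open>Surfaces of parabolic revolution\<close>

fun parabolic_motion ::
    "real \<Rightarrow> real \<Rightarrow> real \<Rightarrow> real \<Rightarrow> real \<Rightarrow> real \<Rightarrow> point3 \<Rightarrow> point3" where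
  "parabolic_motion a b c c1 c2 \<theta> (x, y, z) =
     (x + a * \<theta>, y + b * \<theta>,
      z + c1 * \<theta> * x + c2 * \<theta> * y + c * \<theta> + (a * c1 + b * c2) / 2 * \<theta>\<^sup>2)"

definition parabolic_param ::
    "real \<Rightarrow> real \<Rightarrow> real \<Rightarrow> real \<Rightarrow> real \<Rightarrow> (real \<Rightarrow> real) \<Rightarrow> real \<Rightarrow> real \<Rightarrow> point3" where
  "parabolic_param a b c c1 c2 z t \<theta> =
     (a * \<theta> + t, b * \<theta>,
      c * \<theta> + (a * c1 + b * c2) / 2 * \<theta>\<^sup>2 + c1 * t * \<theta> + z t)"

definition parabolic_surface ::
    "real \<Rightarrow> real \<Rightarrow> real \<Rightarrow> real \<Rightarrow> real \<Rightarrow> (real \<Rightarrow> real) \<Rightarrow> real set \<Rightarrow> point3 set" where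
  "parabolic_surface a b c c1 c2 z I =
     {parabolic_param a b c c1 c2 z t \<theta> | t \<theta>. t \<in> I}"

text \<open>The surface consists of complete orbits. If \<open>a \<noteq> 0\<close>, every orbit crosses the plane
  \<open>x = 0\<close>, so with respect to that plane only the part in \<open>x > 0\<close> can be considered.\<close>

lemma parabolic_param_eq_motion:
  "parabolic_param a b c c1 c2 z t \<theta> = parabolic_motion a b c c1 c2 \<theta> (t, 0, z t)"
  by (simp add: parabolic_param_def algebra_simps)

lemma parabolic_motion_add:
  "parabolic_motion a b c c1 c2 \<theta> (parabolic_motion a b c c1 c2 \<eta> p) =
   parabolic_motion a b c c1 c2 (\<theta> + \<eta>) p"
  by (cases p) (simp add: field_simps power2_eq_square)

lemma parabolic_surface_invariant:
  "p \<in> parabolic_surface a b c c1 c2 z I \<Longrightarrow>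
   parabolic_motion a b c c1 c2 \<theta> p \<in> parabolic_surface a b c c1 c2 z I"
  unfolding parabolic_surface_def parabolic_param_eq_motion mem_Collect_eq
  by (metis parabolic_motion_add)

end

theory Submission
  imports Defs
begin

text \<open>Locally the surface is the graph of \<open>u\<close>, and along an orbit \<open>\<theta> \<mapsto> (a \<theta> + t, b \<theta>)\<close> the
  Laplacian of \<open>u\<close> is constant, the gradient is affine in \<open>\<theta>\<close> and the height is quadratic
  in \<open>\<theta>\<close>. Either minimality equation is therefore a polynomial identity in \<open>\<theta>\<close>. For the plane
  \<open>x = 0\<close>, comparing coefficients gives the claim after integration. For the plane \<open>z = 0\<close> the
  equation is \<open>2 u \<Delta>u = 1 - |\<nabla>u|\<^sup>2\<close>. If \<open>a c1 + b c2 \<noteq> 0\<close>, the leading coefficient forces \<open>\<Delta>u\<close>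
  to be constant and \<open>u\<close> to be a quadratic polynomial; its Hessian \<open>S\<close> then satisfies
  \<open>tr S \<cdot> S = - S\<^sup>2\<close>, whose trace gives \<open>S = 0\<close>, a contradiction. If \<open>a c1 + b c2 = 0\<close>, the leading
  coefficient gives \<open>c1 = c2 = 0\<close>, and positivity of the height on the whole orbit gives \<open>c = 0\<close>.
  So in fact \<open>c2 = 0\<close>, and all terms of the differential equation that contain \<open>c2\<close> vanish.\<close>

section \<open>Partial derivatives of functions given near a point\<close>

lemma open_horizontal_slice: "open {s. (s, y) \<in> U}"
  and open_vertical_slice: "open {s. (x, s) \<in> U}" if "open U" for U :: "(real \<times> real) set"
proof -
  have "open ((\<lambda>s. (s, y)) -` U)" "open ((\<lambda>s. (x, s)) -` U)"
    using that by (auto intro!: continuous_open_vimage continuous_intros)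
  then show "open {s. (s, y) \<in> U}" "open {s. (x, s) \<in> U}"
    by (simp_all add: vimage_def)
qed

text \<open>The formula \<open>g\<close> is kept apart from \<open>f\<close> so that the lemma can
  be iterated: for second derivatives \<open>f\<close> is \<open>pd1 u\<close> or
  \<open>pd2 u\<close>, known only on \<open>U\<close>.\<close>

lemma C1_on_partialsI:
  fixes f g g1 g2 :: "real \<times> real \<Rightarrow> real"
  assumes "open U"
    and eq: "\<And>q. q \<in> U \<Longrightarrow> f q = g q"
    and d1: "\<And>x y. (x, y) \<in> U \<Longrightarrow> ((\<lambda>s. g (s, y)) has_real_derivative g1 (x, y)) (at x)"
    and d2: "\<And>x y. (x, y) \<in> U \<Longrightarrow> ((\<lambda>s. g (x, s)) has_real_derivative g2 (x, y)) (at y)"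
    and cont: "continuous_on U g1" "continuous_on U g2"
  shows "C1_on U f" and "\<And>q. q \<in> U \<Longrightarrow> pd1 f q = g1 q" and "\<And>q. q \<in> U \<Longrightarrow> pd2 f q = g2 q"
proof -
  have f1: "((\<lambda>s. f (s, y)) has_vector_derivative g1 (x, y)) (at x)" if "(x, y) \<in> U" for x y
    using has_field_derivative_transform_within_open[OF d1[OF that] open_horizontal_slice[OF \<open>open U\<close>]]
      that eq by (simp add: has_real_derivative_iff_has_vector_derivative)
  have f2: "((\<lambda>s. f (x, s)) has_vector_derivative g2 (x, y)) (at y)" if "(x, y) \<in> U" for x y
    using has_field_derivative_transform_within_open[OF d2[OF that] open_vertical_slice[OF \<open>open U\<close>]]
      that eq by (simp add: has_real_derivative_iff_has_vector_derivative)
  show p1: "pd1 f q = g1 q" if "q \<in> U" for q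
    using that f1 by (cases q) (simp add: pd1_def vector_derivative_at)
  show p2: "pd2 f q = g2 q" if "q \<in> U" for q
    using that f2 by (cases q) (simp add: pd2_def vector_derivative_at)
  show "C1_on U f"
    unfolding C1_on_def
  proof (intro conjI ballI)
    show "case q of (x, y) \<Rightarrow> (\<lambda>s. f (s, y)) differentiable (at x)
        \<and> (\<lambda>s. f (x, s)) differentiable (at y)" if "q \<in> U" for q
      using that by (cases q) (auto dest: f1 f2 intro: differentiableI_vector)
    show "continuous_on U (pd1 f)" "continuous_on U (pd2 f)"
      using cont by (auto cong: continuous_on_cong simp: p1 p2)
  qed
qed

lemma pd_cong_open:
  fixes f g :: "real \<times> real \<Rightarrow> real"
  assumes "open W" and "\<And>q. q \<in> W \<Longrightarrow> f q = g q" and "q \<in> W"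
  shows "pd1 f q = pd1 g q" and "pd2 f q = pd2 g q"
proof -
  obtain x y where q: "q = (x, y)" by (cases q)
  have "\<forall>\<^sub>F s in nhds x. f (s, y) = g (s, y)"
    using eventually_nhds_in_open[OF open_horizontal_slice[OF \<open>open W\<close>], of x y] assms q
    by (auto elim: eventually_mono)
  then show "pd1 f q = pd1 g q"
    by (auto simp: q pd1_def intro: vector_derivative_cong_eq)
  have "\<forall>\<^sub>F s in nhds y. f (x, s) = g (x, s)"
    using eventually_nhds_in_open[OF open_vertical_slice[OF \<open>open W\<close>], of y x] assms q
    by (auto elim: eventually_mono)
  then show "pd2 f q = pd2 g q"
    by (auto simp: q pd2_def intro: vector_derivative_cong_eq)
qed

text \<open>Since \<open>u\<close> itself satisfies \<open>local_graph\<close>, so does the function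
  picked by \<open>SOME\<close>. Both graphs describe the same set \<open>M\<close> near the point,
  which forces the two functions to agree there.\<close>

lemma graph_fun_eq_near:
  assumes "open U" "open V" "C2_on U u" and cont: "continuous_on U u"
    and graph: "M \<inter> V = {(x, y, u (x, y)) | x y. (x, y) \<in> U}"
    and "(x, y) \<in> U"
  obtains W where "open W" "(x, y) \<in> W"
    "\<And>q. q \<in> W \<Longrightarrow> graph_fun M (x, y, u (x, y)) q = u q"
proof -
  define p where "p = (x, y, u (x, y))"
  have pV: "p \<in> M \<inter> V"
    unfolding graph p_def using assms(6) by blast
  then have "local_graph M p u"
    unfolding local_graph_def using assms by blast
  then have "local_graph M p (graph_fun M p)"
    unfolding graph_fun_def by (rule someI[where P = "local_graph M p"])
  then obtain U' V' where UV': "open V'" "p \<in> V'"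
      "M \<inter> V' = {(x, y, graph_fun M p (x, y)) | x y. (x, y) \<in> U'}"
    unfolding local_graph_def by blast
  \<comment> \<open>\<open>G\<close> lifts a base point to the graph of \<open>u\<close>;
    \<open>W\<close> collects those whose lift lands in \<open>V'\<close>, where \<open>M\<close> is
    also the graph of the chosen function.\<close>
  define G where "G = (\<lambda>q. (fst q, snd q, u q))"
  define W where "W = U \<inter> G -` V'"
  have "continuous_on U G"
    unfolding G_def by (intro continuous_intros cont)
  then have "open W"
    unfolding W_def using \<open>open U\<close> \<open>open V'\<close> by (simp add: continuous_on_open_vimage Int_commute)
  moreover have "(x, y) \<in> W"
    using UV' assms(6) by (simp add: W_def G_def p_def)
  moreover have "graph_fun M p q = u q" if "q \<in> W" for q
  proof -
    have "G q \<in> M"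
      using that graph unfolding W_def G_def by (cases q) auto
    then have "G q \<in> M \<inter> V'"
      using that by (simp add: W_def)
    then show ?thesis
      unfolding UV'(3) G_def by (cases q) auto
  qed
  ultimately show ?thesis
    using that p_def by blast
qed

section \<open>The surface as a graph\<close>

text \<open>Obtained by solving x = a \<theta> + t, y = b \<theta> for the parameters: \<theta> = y
  / b and t = x - (a / b) y.\<close>

definition parabolic_graph ::
    "real \<Rightarrow> real \<Rightarrow> real \<Rightarrow> real \<Rightarrow> real \<Rightarrow> (real \<Rightarrow> real) \<Rightarrow> real \<times> real \<Rightarrow> real" where
  "parabolic_graph a b c c1 c2 z =
     (\<lambda>(x, y). c * (y / b) + (a * c1 + b * c2) / 2 * (y / b)\<^sup>2 + c1 * (x - a / b * y) * (y / b)
        + z (x - a / b * y))"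

lemma parabolic_param_eq_graph:
  "b \<noteq> 0 \<Longrightarrow> parabolic_param a b c c1 c2 z t \<theta> =
     (a * \<theta> + t, b * \<theta>, parabolic_graph a b c c1 c2 z (a * \<theta> + t, b * \<theta>))"
  by (simp add: parabolic_param_def parabolic_graph_def)

lemma parabolic_surface_eq_graph:
  assumes "b \<noteq> 0"
  shows "parabolic_surface a b c c1 c2 z I =
    {(x, y, parabolic_graph a b c c1 c2 z (x, y)) | x y. x - a / b * y \<in> I}"
proof (intro set_eqI iffI)
  fix p assume "p \<in> parabolic_surface a b c c1 c2 z I"
  then obtain t \<theta> where "p = parabolic_param a b c c1 c2 z t \<theta>" "t \<in> I"
    by (auto simp: parabolic_surface_def)
  then show "p \<in> {(x, y, parabolic_graph a b c c1 c2 z (x, y)) | x y. x - a / b * y \<in> I}"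
    using assms by (force simp: parabolic_param_eq_graph)
next
  fix p assume "p \<in> {(x, y, parabolic_graph a b c c1 c2 z (x, y)) | x y. x - a / b * y \<in> I}"
  then obtain x y where p: "p = (x, y, parabolic_graph a b c c1 c2 z (x, y))"
      and I: "x - a / b * y \<in> I"
    by auto
  have "p = parabolic_param a b c c1 c2 z (x - a / b * y) (y / b)"
    using assms by (simp add: p parabolic_param_eq_graph)
  then show "p \<in> parabolic_surface a b c c1 c2 z I"
    using I by (auto simp: parabolic_surface_def)
qed

text \<open>This is the chain rule for t = x - (a / b) y. The set \<open>U\<close> may be smaller
  than the full strip over \<open>I\<close>, so that the surface can later be cut by a
  half-space.\<close>

lemma parabolic_graph_partials:
  fixes a b c c1 c2 :: real and z :: "real \<Rightarrow> real"
  assumes b: "b \<noteq> 0"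
    and "open U" and sub: "U \<subseteq> {q. fst q - a / b * snd q \<in> I}"
    and z: "\<forall>t\<in>I. (z has_real_derivative z' t) (at t)"
    and z': "\<forall>t\<in>I. (z' has_real_derivative z'' t) (at t)"
    and cz'': "continuous_on I z''"
  defines "u \<equiv> parabolic_graph a b c c1 c2 z"
  shows "C2_on U u" and "continuous_on U u"
    and "\<And>x y. (x, y) \<in> U \<Longrightarrow> pd1 u (x, y) = c1 * (y / b) + z' (x - a / b * y)"
    and "\<And>x y. (x, y) \<in> U \<Longrightarrow> pd2 u (x, y) =
      c / b + c2 * (y / b) + c1 * (x - a / b * y) / b - a / b * z' (x - a / b * y)"
    and "\<And>x y. (x, y) \<in> U \<Longrightarrow> pd1 (pd1 u) (x, y) = z'' (x - a / b * y)"
    and "\<And>x y. (x, y) \<in> U \<Longrightarrow> pd2 (pd2 u) (x, y) =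
      c2 / b - a * c1 / b\<^sup>2 + (a / b)\<^sup>2 * z'' (x - a / b * y)"
proof -
  define T where "T = (\<lambda>q. fst q - a / b * snd q)"
  define u1 where "u1 = (\<lambda>q. c1 * (snd q / b) + z' (T q))"
  define u2 where "u2 = (\<lambda>q. c / b + c2 * (snd q / b) + c1 * T q / b - a / b * z' (T q))"
  define u11 where "u11 = (\<lambda>q. z'' (T q))"
  \<comment> \<open>The mixed derivative serves twice, as the y-derivative of \<open>u1\<close> and
    as the x-derivative of \<open>u2\<close>.\<close>
  define u12 where "u12 = (\<lambda>q. c1 / b - a / b * z'' (T q))"
  define u22 where "u22 = (\<lambda>q. c2 / b - a * c1 / b\<^sup>2 + (a / b)\<^sup>2 * z'' (T q))"
  note defs = T_def u1_def u2_def u11_def u12_def u22_def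
  have UI: "x - a / b * y \<in> I" if "(x, y) \<in> U" for x y
    using sub that by auto
  have cont_comp: "continuous_on U (\<lambda>q. h (T q))" if "continuous_on I h" for h :: "real \<Rightarrow> real"
  proof (rule continuous_on_compose2[OF that])
    show "continuous_on U T"
      unfolding T_def by (intro continuous_intros)
    show "T ` U \<subseteq> I"
      using UI by (auto simp: T_def)
  qed
  have cT: "continuous_on U T"
    unfolding T_def by (intro continuous_intros)
  have cz: "continuous_on U (\<lambda>q. z (T q))"
    by (intro cont_comp) (meson z DERIV_isCont continuous_at_imp_continuous_on)
  have cz': "continuous_on U (\<lambda>q. z' (T q))"
    by (intro cont_comp) (meson z' DERIV_isCont continuous_at_imp_continuous_on)
  have cz'': "continuous_on U (\<lambda>q. z'' (T q))"
    by (intro cont_comp cz'')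
  have u_T: "u = (\<lambda>q. c * (snd q / b) + (a * c1 + b * c2) / 2 * (snd q / b)\<^sup>2
      + c1 * T q * (snd q / b) + z (T q))"
    by (auto simp: u_def parabolic_graph_def T_def)
  show cu: "continuous_on U u"
    unfolding u_T using b by (intro continuous_intros cz cT) auto
  have cu12: "continuous_on U u1" "continuous_on U u2" "continuous_on U u11"
      "continuous_on U u12" "continuous_on U u22"
    unfolding u1_def u2_def u11_def u12_def u22_def
    using b by (auto intro!: continuous_intros cz' cz'' cT)

  have z1: "((\<lambda>s. h (s - a / b * y)) has_real_derivative h' (x - a / b * y)) (at x)"
    and z2: "((\<lambda>s. h (x - a / b * s)) has_real_derivative - (a / b) * h' (x - a / b * y)) (at y)"
    if "(x, y) \<in> U" and h: "\<forall>t\<in>I. (h has_real_derivative h' t) (at t)"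
    for h h' :: "real \<Rightarrow> real" and x y
  proof -
    have "((\<lambda>s. s - a / b * y) has_real_derivative 1) (at x)"
      by (auto intro!: derivative_eq_intros)
    from DERIV_chain2[OF h[rule_format, OF UI[OF that(1)]] this]
    show "((\<lambda>s. h (s - a / b * y)) has_real_derivative h' (x - a / b * y)) (at x)"
      by simp
    have "((\<lambda>s. x - a / b * s) has_real_derivative - (a / b)) (at y)"
      by (rule derivative_eq_intros refl b)+ (use b in simp)
    from DERIV_chain2[OF h[rule_format, OF UI[OF that(1)]] this]
    show "((\<lambda>s. h (x - a / b * s)) has_real_derivative - (a / b) * h' (x - a / b * y)) (at y)"
      by (simp add: mult.commute)
  qed

  have C1u: "C1_on U u" and pu1: "\<And>q. q \<in> U \<Longrightarrow> pd1 u q = u1 q"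
      and pu2: "\<And>q. q \<in> U \<Longrightarrow> pd2 u q = u2 q"
  proof -
    have d1: "((\<lambda>s. u (s, y)) has_real_derivative u1 (x, y)) (at x)" if "(x, y) \<in> U" for x y
      unfolding u_T u1_def T_def fst_conv snd_conv
      by (rule derivative_eq_intros z1[OF that z] refl b)+ (use b in simp)
    have d2: "((\<lambda>s. u (x, s)) has_real_derivative u2 (x, y)) (at y)" if "(x, y) \<in> U" for x y
      unfolding u_T u2_def T_def fst_conv snd_conv
      by (rule derivative_eq_intros z2[OF that z] refl b)+
        (use b in \<open>simp add: field_simps power2_eq_square\<close>)
    note C1_on_partialsI[OF \<open>open U\<close> refl d1 d2 cu12(1,2)]
    then show "C1_on U u" "\<And>q. q \<in> U \<Longrightarrow> pd1 u q = u1 q" "\<And>q. q \<in> U \<Longrightarrow> pd2 u q = u2 q"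
      by blast+
  qed
  have C1u1: "C1_on U (pd1 u)" and pu11: "\<And>q. q \<in> U \<Longrightarrow> pd1 (pd1 u) q = u11 q"
  proof -
    have d1: "((\<lambda>s. u1 (s, y)) has_real_derivative u11 (x, y)) (at x)" if "(x, y) \<in> U" for x y
      unfolding u1_def u11_def T_def fst_conv snd_conv
      by (rule derivative_eq_intros z1[OF that z'] refl b)+ (use b in simp)
    have d2: "((\<lambda>s. u1 (x, s)) has_real_derivative u12 (x, y)) (at y)" if "(x, y) \<in> U" for x y
      unfolding u1_def u12_def T_def fst_conv snd_conv
      by (rule derivative_eq_intros z2[OF that z'] refl b)+
        (use b in \<open>simp add: field_simps power2_eq_square\<close>)
    note C1_on_partialsI[OF \<open>open U\<close> pu1 d1 d2 cu12(3,4)]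
    then show "C1_on U (pd1 u)" "\<And>q. q \<in> U \<Longrightarrow> pd1 (pd1 u) q = u11 q"
      by blast+
  qed
  have C1u2: "C1_on U (pd2 u)" and pu22: "\<And>q. q \<in> U \<Longrightarrow> pd2 (pd2 u) q = u22 q"
  proof -
    have d1: "((\<lambda>s. u2 (s, y)) has_real_derivative u12 (x, y)) (at x)" if "(x, y) \<in> U" for x y
      unfolding u2_def u12_def T_def fst_conv snd_conv
      by (rule derivative_eq_intros z1[OF that z'] refl b)+ (use b in simp)
    have d2: "((\<lambda>s. u2 (x, s)) has_real_derivative u22 (x, y)) (at y)" if "(x, y) \<in> U" for x y
      unfolding u2_def u22_def T_def fst_conv snd_conv
      by (rule derivative_eq_intros z2[OF that z'] refl b)+
        (use b in \<open>simp add: field_simps power2_eq_square\<close>)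
    note C1_on_partialsI[OF \<open>open U\<close> pu2 d1 d2 cu12(4,5)]
    then show "C1_on U (pd2 u)" "\<And>q. q \<in> U \<Longrightarrow> pd2 (pd2 u) q = u22 q"
      by blast+
  qed
  show "C2_on U u"
    unfolding C2_on_def using C1u C1u1 C1u2 by blast
  show "pd1 u (x, y) = c1 * (y / b) + z' (x - a / b * y)" if "(x, y) \<in> U" for x y
    using pu1[OF that] by (simp add: defs)
  show "pd2 u (x, y) =
      c / b + c2 * (y / b) + c1 * (x - a / b * y) / b - a / b * z' (x - a / b * y)"
    if "(x, y) \<in> U" for x y
    using pu2[OF that] by (simp add: defs)
  show "pd1 (pd1 u) (x, y) = z'' (x - a / b * y)" if "(x, y) \<in> U" for x y
    using pu11[OF that] by (simp add: defs)
  show "pd2 (pd2 u) (x, y) = c2 / b - a * c1 / b\<^sup>2 + (a / b)\<^sup>2 * z'' (x - a / b * y)"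
    if "(x, y) \<in> U" for x y
    using pu22[OF that] by (simp add: defs)
qed

text \<open>The open set \<open>H\<close> covers both reference planes: it is the half-space x > 0
  for one and the whole space for the other. The Laplacian depends on \<open>t\<close> alone, while
  the gradient is affine in \<open>\<theta>\<close>.\<close>

lemma parabolic_surface_curvature:
  fixes a b c c1 c2 \<theta> :: real and z :: "real \<Rightarrow> real" and V :: "point3 set"
  assumes b: "b \<noteq> 0" and "open I" and "open H"
    and z: "\<forall>t\<in>I. (z has_real_derivative z' t) (at t)"
    and z': "\<forall>t\<in>I. (z' has_real_derivative z'' t) (at t)"
    and cz'': "continuous_on I z''"
    and t: "t \<in> I" and H: "parabolic_param a b c c1 c2 z t \<theta> \<in> H"
  defines "p \<equiv> parabolic_param a b c c1 c2 z t \<theta>"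
    and "M \<equiv> parabolic_surface a b c c1 c2 z I \<inter> H"
    and "ux \<equiv> c1 * \<theta> + z' t"
    and "uy \<equiv> c / b + c2 * \<theta> + c1 * t / b - a / b * z' t"
  shows "mean_curvature M p = ((1 + (a / b)\<^sup>2) * z'' t + c2 / b - a * c1 / b\<^sup>2) / 2"
    and "parabolic_normal M p = (- ux, - uy, 1 / 2 - (ux\<^sup>2 + uy\<^sup>2) / 2)"
proof -
  let ?u = "parabolic_graph a b c c1 c2 z"
  define U0 where "U0 = {q. fst q - a / b * snd q \<in> I}"
  have "U0 = (\<lambda>q. fst q - a / b * snd q) -` I"
    by (auto simp: U0_def)
  then have "open U0"
    using \<open>open I\<close> b by (simp, intro continuous_open_vimage continuous_intros) auto
  \<comment> \<open>Continuity is needed on \<open>U0\<close> first, because the openness of the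
    smaller set \<open>U\<close> rests on it.\<close>
  have cu0: "continuous_on U0 ?u"
    using \<open>open U0\<close> by (rule parabolic_graph_partials(2)[OF b _ _ z z' cz'']) (simp add: U0_def)
  define U where "U = U0 \<inter> (\<lambda>q. (fst q, snd q, ?u q)) -` H"
  have "continuous_on U0 (\<lambda>q. (fst q, snd q, ?u q))"
    by (intro continuous_intros cu0)
  then have "open U"
    unfolding U_def using \<open>open U0\<close> \<open>open H\<close> by (simp add: continuous_on_open_vimage Int_commute)
  have sub: "U \<subseteq> {q. fst q - a / b * snd q \<in> I}"
    by (auto simp: U_def U0_def)
  note partials = parabolic_graph_partials[OF b \<open>open U\<close> sub z z' cz'', where c = c and ?c1.0 = c1 and ?c2.0 = c2]
  define x y where "x = a * \<theta> + t" and "y = b * \<theta>"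
  have p_eq: "p = (x, y, ?u (x, y))"
    using b by (simp add: p_def x_def y_def parabolic_param_eq_graph)
  have xt: "x - a / b * y = t" and y\<theta>: "y / b = \<theta>"
    using b by (simp_all add: x_def y_def)
  have xyU: "(x, y) \<in> U"
    using t H p_eq xt by (simp add: U_def U0_def p_def)
  have graph: "M \<inter> UNIV = {(x, y, ?u (x, y)) | x y. (x, y) \<in> U}"
    unfolding M_def parabolic_surface_eq_graph[OF b] by (auto simp: U_def U0_def)
  obtain W where W: "open W" "(x, y) \<in> W" "\<And>q. q \<in> W \<Longrightarrow> graph_fun M p q = ?u q"
    using graph_fun_eq_near[OF \<open>open U\<close> open_UNIV partials(1,2) graph xyU]
    unfolding p_eq by blast
  have g: "pd1 (graph_fun M p) q = pd1 ?u q" "pd2 (graph_fun M p) q = pd2 ?u q" if "q \<in> W" for q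
    using pd_cong_open[OF W(1) W(3) that] by simp_all
  \<comment> \<open>The first derivatives agree on all of the open set \<open>W\<close>, not only at
    the point, so they can be differentiated once more.\<close>
  have gg: "pd1 (pd1 (graph_fun M p)) (x, y) = pd1 (pd1 ?u) (x, y)"
      "pd2 (pd2 (graph_fun M p)) (x, y) = pd2 (pd2 ?u) (x, y)"
    using W(2) by (auto intro!: pd_cong_open[OF W(1)] g)
  show "mean_curvature M p = ((1 + (a / b)\<^sup>2) * z'' t + c2 / b - a * c1 / b\<^sup>2) / 2"
    using gg partials(5,6)[OF xyU] unfolding mean_curvature_def Let_def xt
    by (simp add: p_eq algebra_simps add_divide_distrib)
  show "parabolic_normal M p = (- ux, - uy, 1 / 2 - (ux\<^sup>2 + uy\<^sup>2) / 2)"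
    using g[OF W(2)] partials(3,4)[OF xyU] unfolding parabolic_normal_def Let_def xt y\<theta>
    by (simp add: p_eq ux_def uy_def)
qed

section \<open>Singular minimal surfaces of parabolic revolution\<close>

lemma quadratic_vanishes:
  fixes \<alpha> \<beta> \<gamma> :: real
  assumes "\<And>\<theta>. \<alpha> * \<theta>\<^sup>2 + \<beta> * \<theta> + \<gamma> = 0"
  shows "\<alpha> = 0" and "\<beta> = 0" and "\<gamma> = 0"
  using assms[of 0] assms[of 1] assms[of "-1"] by simp_all

lemma affine_pos_imp_constant:
  fixes \<alpha> \<beta> :: real
  assumes "\<And>\<theta>. \<alpha> * \<theta> + \<beta> > 0"
  shows "\<alpha> = 0"
  using assms[of "- \<beta> / \<alpha>"] by (cases "\<alpha> = 0") auto

text \<open>Used to differentiate an identity that holds on an open set: the derivatives of both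
  sides must coincide.\<close>

lemma has_real_derivative_unique_open:
  fixes f g :: "real \<Rightarrow> real"
  assumes "open I" "t \<in> I" "\<And>s. s \<in> I \<Longrightarrow> f s = g s"
    and "(f has_real_derivative d) (at t)" "(g has_real_derivative e) (at t)"
  shows "d = e"
  using has_field_derivative_transform_within_open[OF assms(4,1,2,3)] assms(5) DERIV_unique by blast

text \<open>The source of the integration constants; one constant suffices because an interval is
  connected.\<close>

lemma eq_add_const_on_interval:
  fixes f g :: "real \<Rightarrow> real"
  assumes "is_interval I"
    and "\<And>t. t \<in> I \<Longrightarrow> (f has_real_derivative h t) (at t)"
    and "\<And>t. t \<in> I \<Longrightarrow> (g has_real_derivative h t) (at t)"
  shows "\<exists>k. \<forall>t\<in>I. f t = g t + k"
proof -
  have "convex I"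
    using assms(1) by (rule is_interval_convex)
  have "((\<lambda>t. f t - g t) has_real_derivative 0) (at t within I)" if "t \<in> I" for t
    using DERIV_diff[OF assms(2,3)[OF that]] by (auto intro: has_field_derivative_at_within)
  then obtain k where "\<And>t. t \<in> I \<Longrightarrow> f t - g t = k"
    using has_field_derivative_zero_constant[OF \<open>convex I\<close>, of "\<lambda>t. f t - g t"] by auto
  then show ?thesis
    by (intro exI[of _ k]) (simp add: algebra_simps)
qed

text \<open>The matrix with rows \<open>(p, q)\<close> and \<open>(q, r)\<close> is the Hessian \<open>S\<close> of \<open>u\<close>; the assumptions
  are the entries of \<open>tr S \<cdot> S = - S\<^sup>2\<close>, evaluated on the basis \<open>(1, 0)\<close>, \<open>(a, b)\<close>.\<close>

lemma hessian_zero: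
  fixes p q r a b :: real
  assumes "b \<noteq> 0"
  defines "v1 \<equiv> a * p + b * q" and "v2 \<equiv> a * q + b * r"
  assumes e1: "p * (p + r) = - (p\<^sup>2 + q\<^sup>2)"
    and e2: "v1 * (p + r) = - (p * v1 + q * v2)"
    and e3: "(a * v1 + b * v2) * (p + r) = - (v1\<^sup>2 + v2\<^sup>2)"
  shows "p = 0 \<and> q = 0 \<and> r = 0"
proof -
  \<comment> \<open>Subtracting \<open>a\<close> times \<open>e1\<close> from \<open>e2\<close>
    leaves the off-diagonal entry, which equals its own negative.\<close>
  have "b * (q * (p + r)) = - (b * (q * (p + r)))"
    using e1 e2 unfolding v1_def v2_def by algebra
  then have q: "q * (p + r) = 0"
    using \<open>b \<noteq> 0\<close> by simp
  have "b\<^sup>2 * (r * (p + r)) = - (b\<^sup>2 * (q\<^sup>2 + r\<^sup>2))"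
    using e1 e3 q unfolding v1_def v2_def by algebra
  then have "r * (p + r) = - (q\<^sup>2 + r\<^sup>2)"
    using \<open>b \<noteq> 0\<close> by (metis mult_minus_right mult_left_cancel zero_eq_power2)
  \<comment> \<open>Adding the two diagonal entries gives the trace identity, a vanishing sum of
    squares.\<close>
  with e1 have "(p + r)\<^sup>2 + p\<^sup>2 + 2 * q\<^sup>2 + r\<^sup>2 = 0"
    by (simp add: algebra_simps power2_eq_square)
  moreover have "(p + r)\<^sup>2 \<ge> 0" "p\<^sup>2 \<ge> 0" "q\<^sup>2 \<ge> 0" "r\<^sup>2 \<ge> 0"
    by simp_all
  ultimately have "p\<^sup>2 = 0" "q\<^sup>2 = 0" "r\<^sup>2 = 0"
    by linarith+
  then show ?thesis
    by simp
qed

section \<open>The isotropic reference plane x = 0\<close>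

lemma singular_minimal_yz_profile:
  fixes z z' z'' :: "real \<Rightarrow> real"
  assumes b: "b \<noteq> 0" and "open I" and "is_interval I" and "I \<noteq> {}"
    and z: "\<forall>t\<in>I. (z has_real_derivative z' t) (at t)"
    and z': "\<forall>t\<in>I. (z' has_real_derivative z'' t) (at t)"
    and cz'': "continuous_on I z''"
    and min: "isotropic_singular_minimal_yz (parabolic_surface a b c c1 c2 z I \<inter> half_space_x)"
    and meet: "\<And>t. t \<in> I \<Longrightarrow> \<exists>\<theta>. parabolic_param a b c c1 c2 z t \<theta> \<in> half_space_x"
  shows "a = 0 \<Longrightarrow> c1 = 0 \<and> (\<exists>z1 z2. \<forall>t\<in>I. z t = - (c2 / (4 * b)) * t\<^sup>2 + z2 * ln t + z1)"
    and "a \<noteq> 0 \<Longrightarrow> a * c2 + 2 * b * c1 = 0 \<and> (\<exists>z1. \<forall>t\<in>I. z t = c1 / (2 * a) * t\<^sup>2 + z1)"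
proof -
  \<comment> \<open>\<open>A t\<close> is the Laplacian of the graph function along the orbit of
    \<open>t\<close>, that is, twice the mean curvature.\<close>
  define A where "A = (\<lambda>t. (1 + (a / b)\<^sup>2) * z'' t + c2 / b - a * c1 / b\<^sup>2)"
  have mem_half: "parabolic_param a b c c1 c2 z t \<theta> \<in> half_space_x \<longleftrightarrow> a * \<theta> + t > 0" for t \<theta>
    by (simp add: parabolic_param_def half_space_x_def)
  have half: "half_space_x = {0<..} \<times> UNIV"
    by (auto simp: half_space_x_def)
  have "open half_space_x"
    by (simp add: half open_Times)
  have eq: "A t * (a * \<theta> + t) = - (c1 * \<theta> + z' t)" if "t \<in> I" "a * \<theta> + t > 0" for t \<theta>
  proof -
    let ?p = "parabolic_param a b c c1 c2 z t \<theta>"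
    have "?p \<in> half_space_x"
      using that by (simp add: mem_half)
    note curv = parabolic_surface_curvature[OF b \<open>open I\<close> \<open>open half_space_x\<close> z z' cz'' \<open>t \<in> I\<close> this]
    have "?p \<in> parabolic_surface a b c c1 c2 z I \<inter> half_space_x"
      using that by (auto simp: mem_half parabolic_surface_def)
    then have "A t / 2 = - (c1 * \<theta> + z' t) / (2 * dist_plane_yz ?p)"
      using min curv unfolding isotropic_singular_minimal_yz_def A_def by simp
    then show ?thesis
      using that by (simp add: parabolic_param_def field_simps)
  qed
  have coeffs: "A t * a = - c1" "A t * t = - z' t" if "t \<in> I" for t
  proof -
    obtain \<theta> where \<theta>: "a * \<theta> + t > 0"
      using meet[OF \<open>t \<in> I\<close>] by (auto simp: mem_half)
    \<comment> \<open>The sign of \<open>d\<close> makes a * d nonnegative, so the shifted parameter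
      stays in x > 0. Two points of the orbit determine both coefficients of an affine
      identity.\<close>
    define d where "d = (if a < 0 then -1 else 1 :: real)"
    have "a * (\<theta> + d) + t > 0" "d \<noteq> 0"
      using \<theta> by (auto simp: d_def algebra_simps)
    then have "A t * (a * (\<theta> + d) + t) = - (c1 * (\<theta> + d) + z' t)"
      using eq that by blast
    with eq[OF that \<theta>] have "d * (A t * a) = d * (- c1)"
      by (simp add: algebra_simps)
    with \<open>d \<noteq> 0\<close> show "A t * a = - c1"
      by (metis mult_left_cancel)
    then have "A t * a * \<theta> = - c1 * \<theta>"
      by simp
    with eq[OF that \<theta>] show "A t * t = - z' t"
      by (simp add: algebra_simps)
  qed
  {
    assume "a = 0"
    have c1: "c1 = 0"
      using coeffs(1) \<open>a = 0\<close> \<open>I \<noteq> {}\<close> by auto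
    have pos: "t > 0" if "t \<in> I" for t
      using meet[OF that] unfolding mem_half by (simp add: \<open>a = 0\<close>)
    \<comment> \<open>The left-hand side is the derivative of t * z' t, so two integrations solve
      the equation; the constant \<open>k\<close> of the first becomes the coefficient of the
      logarithm.\<close>
    have ode: "t * z'' t + z' t = - (c2 / b) * t" if "t \<in> I" for t
      using coeffs(2)[OF that] \<open>a = 0\<close> by (simp add: A_def algebra_simps)
    have "\<exists>k. \<forall>t\<in>I. t * z' t = - (c2 / (2 * b)) * t\<^sup>2 + k"
    proof (rule eq_add_const_on_interval[OF \<open>is_interval I\<close>])
      show "((\<lambda>t. t * z' t) has_real_derivative - (c2 / b) * t) (at t)" if "t \<in> I" for t
        by (rule derivative_eq_intros z'[rule_format, OF that] refl)+ (use ode[OF that] in \<open>simp add: algebra_simps\<close>)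
      show "((\<lambda>t. - (c2 / (2 * b)) * t\<^sup>2) has_real_derivative - (c2 / b) * t) (at t)" for t
        by (rule derivative_eq_intros refl)+ simp
    qed
    then obtain k where k: "\<And>t. t \<in> I \<Longrightarrow> t * z' t = - (c2 / (2 * b)) * t\<^sup>2 + k"
      by blast
    have "\<exists>z1. \<forall>t\<in>I. z t = - (c2 / (4 * b)) * t\<^sup>2 + k * ln t + z1"
    proof (rule eq_add_const_on_interval[OF \<open>is_interval I\<close> z[rule_format]])
      fix t assume "t \<in> I"
      have "z' t = - (c2 / (2 * b)) * t + k / t"
        using k[OF \<open>t \<in> I\<close>] pos[OF \<open>t \<in> I\<close>] b by (simp add: field_simps power2_eq_square)
      then show "((\<lambda>t. - (c2 / (4 * b)) * t\<^sup>2 + k * ln t) has_real_derivative z' t) (at t)"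
        by - (rule derivative_eq_intros refl pos[OF \<open>t \<in> I\<close>] | simp)+
    qed
    with c1 show "c1 = 0 \<and> (\<exists>z1 z2. \<forall>t\<in>I. z t = - (c2 / (4 * b)) * t\<^sup>2 + z2 * ln t + z1)"
      by blast
  next
    assume "a \<noteq> 0"
    have z'_eq: "z' t = c1 / a * t" if "t \<in> I" for t
    proof -
      have "A t = - c1 / a"
        using coeffs(1)[OF that] \<open>a \<noteq> 0\<close> by (simp add: field_simps)
      then show ?thesis
        using coeffs(2)[OF that] by simp
    qed
    obtain t where "t \<in> I"
      using \<open>I \<noteq> {}\<close> by blast
    \<comment> \<open>The linear formula for \<open>z'\<close> fixes \<open>z''\<close>; inserting
      it into \<open>A\<close> turns the first coefficient equation into a relation between the
      constants.\<close>
    have "((\<lambda>t. c1 / a * t) has_real_derivative c1 / a) (at t)"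
      by (rule DERIV_cmult_Id)
    then have "z'' t = c1 / a"
      using has_real_derivative_unique_open[OF \<open>open I\<close> \<open>t \<in> I\<close> z'_eq z'[rule_format, OF \<open>t \<in> I\<close>]] by blast
    then have "((1 + (a / b)\<^sup>2) * (c1 / a) + c2 / b - a * c1 / b\<^sup>2) * a = - c1"
      using coeffs(1)[OF \<open>t \<in> I\<close>] by (simp add: A_def)
    moreover have "((1 + (a / b)\<^sup>2) * (c1 / a) + c2 / b - a * c1 / b\<^sup>2) * a + c1
        = (a * c2 + 2 * b * c1) / b"
      using \<open>a \<noteq> 0\<close> b by (simp add: field_simps power2_eq_square)
    ultimately have "a * c2 + 2 * b * c1 = 0"
      using b by simp
    moreover have "\<exists>z1. \<forall>t\<in>I. z t = c1 / (2 * a) * t\<^sup>2 + z1"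
    proof (rule eq_add_const_on_interval[OF \<open>is_interval I\<close> z[rule_format]])
      show "((\<lambda>t. c1 / (2 * a) * t\<^sup>2) has_real_derivative z' t) (at t)" if "t \<in> I" for t
        by (rule derivative_eq_intros refl)+ (simp add: z'_eq[OF that])
    qed
    ultimately show "a * c2 + 2 * b * c1 = 0 \<and> (\<exists>z1. \<forall>t\<in>I. z t = c1 / (2 * a) * t\<^sup>2 + z1)"
      by blast
  }
qed

section \<open>The non-isotropic reference plane z = 0\<close>

lemma singular_minimal_xy_profile:
  fixes z z' z'' :: "real \<Rightarrow> real"
  assumes b: "b \<noteq> 0" and "open I" and "I \<noteq> {}"
    and z: "\<forall>t\<in>I. (z has_real_derivative z' t) (at t)"
    and z': "\<forall>t\<in>I. (z' has_real_derivative z'' t) (at t)"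
    and cz'': "continuous_on I z''"
    and min: "isotropic_singular_minimal_xy (parabolic_surface a b c c1 c2 z I)"
  shows "c = 0" and "c1 = 0" and "c2 = 0"
    and "\<And>t. t \<in> I \<Longrightarrow> 2 * z t * z'' t + (z' t)\<^sup>2 = b\<^sup>2 / (a\<^sup>2 + b\<^sup>2)"
proof -
  define k where "k = a / b"
  define A where "A = (\<lambda>t. (1 + k\<^sup>2) * z'' t + c2 / b - a * c1 / b\<^sup>2)"
  \<comment> \<open>\<open>P\<close> is the second derivative of the height along an orbit, and
    \<open>w t\<close> is the y-derivative of the graph function at \<theta> = 0.\<close>
  define P where "P = a * c1 + b * c2"
  define w where "w = (\<lambda>t. c / b + c1 * t / b - k * z' t)"
  have height: "c * \<theta> + P / 2 * \<theta>\<^sup>2 + c1 * t * \<theta> + z t > 0"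
    and eq: "2 * (c * \<theta> + P / 2 * \<theta>\<^sup>2 + c1 * t * \<theta> + z t) * A t
      = 1 - (c1 * \<theta> + z' t)\<^sup>2 - (c2 * \<theta> + w t)\<^sup>2" if "t \<in> I" for t \<theta>
  proof -
    let ?p = "parabolic_param a b c c1 c2 z t \<theta>"
    have mem: "?p \<in> parabolic_surface a b c c1 c2 z I"
      using that by (auto simp: parabolic_surface_def)
    then have "?p \<in> half_space_z"
      using min by (auto simp: isotropic_singular_minimal_xy_def)
    then show pos: "c * \<theta> + P / 2 * \<theta>\<^sup>2 + c1 * t * \<theta> + z t > 0"
      by (simp add: parabolic_param_def half_space_z_def P_def)
    note curv = parabolic_surface_curvature[OF b \<open>open I\<close> open_UNIV z z' cz'' \<open>t \<in> I\<close> UNIV_I,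
        where \<theta> = \<theta> and a = a and c = c and ?c1.0 = c1 and ?c2.0 = c2, unfolded Int_UNIV_right]
    have w_eq: "c / b + c2 * \<theta> + c1 * t / b - a / b * z' t = c2 * \<theta> + w t"
      by (simp add: w_def k_def)
    have "A t / 2 = (1 / 2 - ((c1 * \<theta> + z' t)\<^sup>2 + (c2 * \<theta> + w t)\<^sup>2) / 2)
        / (2 * (c * \<theta> + P / 2 * \<theta>\<^sup>2 + c1 * t * \<theta> + z t))"
      using min mem curv unfolding isotropic_singular_minimal_xy_def A_def k_def w_eq
      by (simp add: parabolic_param_def P_def)
    then show "2 * (c * \<theta> + P / 2 * \<theta>\<^sup>2 + c1 * t * \<theta> + z t) * A t
      = 1 - (c1 * \<theta> + z' t)\<^sup>2 - (c2 * \<theta> + w t)\<^sup>2"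
      using pos by (simp add: field_simps)
  qed
  \<comment> \<open>These are the coefficients of \<open>\<theta>\<^sup>2\<close>, of \<theta>
    (halved) and of 1 in \<open>eq\<close>.\<close>
  have quad: "P * A t + (c1\<^sup>2 + c2\<^sup>2) = 0"
    and lin: "(c + c1 * t) * A t + (c1 * z' t + c2 * w t) = 0"
    and const: "2 * z t * A t = 1 - (z' t)\<^sup>2 - (w t)\<^sup>2" if "t \<in> I" for t
  proof -
    have "(P * A t + (c1\<^sup>2 + c2\<^sup>2)) * \<theta>\<^sup>2
        + 2 * ((c + c1 * t) * A t + (c1 * z' t + c2 * w t)) * \<theta>
        + (2 * z t * A t - (1 - (z' t)\<^sup>2 - (w t)\<^sup>2)) = 0" for \<theta>
      using eq[OF that, of \<theta>] by (simp add: algebra_simps power2_eq_square)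
    from quadratic_vanishes[OF this]
    show "P * A t + (c1\<^sup>2 + c2\<^sup>2) = 0" "(c + c1 * t) * A t + (c1 * z' t + c2 * w t) = 0"
      "2 * z t * A t = 1 - (z' t)\<^sup>2 - (w t)\<^sup>2"
      by simp_all
  qed
  obtain t0 where t0: "t0 \<in> I"
    using \<open>I \<noteq> {}\<close> by blast
  have "P = 0"
  proof (rule ccontr)
    assume "P \<noteq> 0"
    \<comment> \<open>\<open>A0\<close> is the constant value that \<open>quad\<close> forces on
      \<open>A\<close>. The numbers \<open>p\<close>, \<open>q\<close>, \<open>r\<close> are the
      resulting constant second derivatives in xx, xy and yy.\<close>
    define A0 p where "A0 = - (c1\<^sup>2 + c2\<^sup>2) / P" and "p = (A0 + a * c1 / b\<^sup>2 - c2 / b) / (1 + k\<^sup>2)"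
    define q r where "q = c1 / b - k * p" and "r = (c2 - a * q) / b"
    have A: "A t = A0" if "t \<in> I" for t
      using quad[OF that] \<open>P \<noteq> 0\<close> by (simp add: A0_def field_simps)
    have "1 + k\<^sup>2 \<noteq> 0"
      by (metis add_nonneg_eq_0_iff zero_le_one zero_le_power2 zero_neq_one)
    then have z''_eq: "z'' t = p" if "t \<in> I" for t
      using A[OF that] by (simp add: p_def A_def field_simps)
    \<comment> \<open>The gradient moves along an orbit with velocity (c1, c2), which is the Hessian
      applied to the orbit direction (a, b).\<close>
    have c1_eq: "c1 = a * p + b * q" and c2_eq: "c2 = a * q + b * r"
      using b by (simp_all add: q_def r_def k_def field_simps)
    have A0_eq: "A0 = p + r"
    proof -
      have "r = c2 / b - k * q" "a * c1 / b\<^sup>2 = k * (c1 / b)"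
        by (simp_all add: r_def k_def diff_divide_distrib power2_eq_square)
      then show ?thesis
        using A[OF t0] unfolding A_def z''_eq[OF t0]
        by (simp add: q_def algebra_simps power2_eq_square)
    qed
    have dz': "(z' has_real_derivative p) (at t)" if "t \<in> I" for t
      using z'[rule_format, OF that] z''_eq[OF that] by simp
    have dw: "(w has_real_derivative q) (at t)" if "t \<in> I" for t
      unfolding w_def q_def
      by (rule derivative_eq_intros dz'[rule_format, OF that] refl b)+ (use b in \<open>simp add: field_simps\<close>)
    \<comment> \<open>With \<open>A\<close> replaced by the constant \<open>A0\<close>,
      differentiating \<open>const\<close> in \<open>t\<close> involves no third derivative of
      \<open>z\<close>. A second differentiation yields the Hessian entry for the direction (1, 0)
      taken twice.\<close>
    have const': "z' t * A0 = - (z' t * p + w t * q)" if "t \<in> I" for t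
    proof -
      have "2 * z' t * A0 = - 2 * z' t * p - 2 * w t * q"
      proof (rule has_real_derivative_unique_open[OF \<open>open I\<close> that])
        show "2 * z s * A0 = 1 - (z' s)\<^sup>2 - (w s)\<^sup>2" if "s \<in> I" for s
          using const[OF that] A[OF that] by simp
        show "((\<lambda>s. 2 * z s * A0) has_real_derivative 2 * z' t * A0) (at t)"
          by (rule derivative_eq_intros z[rule_format, OF that] refl)+ simp
        show "((\<lambda>s. 1 - (z' s)\<^sup>2 - (w s)\<^sup>2) has_real_derivative
            - 2 * z' t * p - 2 * w t * q) (at t)"
          by (rule derivative_eq_intros dz'[rule_format, OF that] dw[OF that] refl)+ simp
      qed
      then show ?thesis by simp
    qed
    have "p * A0 = - (p * p + q * q)"
    proof (rule has_real_derivative_unique_open[OF \<open>open I\<close> t0 const'])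
      show "((\<lambda>s. z' s * A0) has_real_derivative p * A0) (at t0)"
        by (rule derivative_eq_intros dz'[rule_format, OF t0] refl)+ simp
      show "((\<lambda>s. - (z' s * p + w s * q)) has_real_derivative - (p * p + q * q)) (at t0)"
        by (rule derivative_eq_intros dz'[rule_format, OF t0] dw[OF t0] refl)+ simp
    qed
    then have e1: "p * (p + r) = - (p\<^sup>2 + q\<^sup>2)"
      by (simp add: A0_eq power2_eq_square)
    \<comment> \<open>Differentiating \<open>lin\<close> gives the entry for the directions (1, 0)
      and (a, b); the entry for (a, b) taken twice is \<open>quad\<close> itself.\<close>
    have "c1 * A0 + (c1 * p + c2 * q) = 0"
    proof (rule has_real_derivative_unique_open[OF \<open>open I\<close> t0])
      show "(c + c1 * s) * A0 + (c1 * z' s + c2 * w s) = 0" if "s \<in> I" for s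
        using lin[OF that] A[OF that] by simp
      show "((\<lambda>s. (c + c1 * s) * A0 + (c1 * z' s + c2 * w s)) has_real_derivative
          c1 * A0 + (c1 * p + c2 * q)) (at t0)"
        by (rule derivative_eq_intros dz'[rule_format, OF t0] dw[OF t0] refl)+ simp
      show "((\<lambda>s. 0) has_real_derivative 0) (at t0)"
        by simp
    qed
    then have e2: "c1 * (p + r) = - (p * c1 + q * c2)"
      by (simp add: A0_eq algebra_simps)
    have e3: "(a * c1 + b * c2) * (p + r) = - (c1\<^sup>2 + c2\<^sup>2)"
      using quad[OF t0] unfolding A[OF t0] A0_eq P_def by simp
    have "p = 0 \<and> q = 0 \<and> r = 0"
      using hessian_zero[OF b e1] e2 e3 unfolding c1_eq c2_eq by blast
    then show False
      using \<open>P \<noteq> 0\<close> c1_eq c2_eq by (simp add: P_def)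
  qed
  with quad[OF t0] have "c1\<^sup>2 + c2\<^sup>2 = 0"
    by simp
  then show c12: "c1 = 0" "c2 = 0"
    by (simp_all add: sum_power2_eq_zero_iff)
  have "c * \<theta> + z t0 > 0" for \<theta>
    using height[OF t0, of \<theta>] \<open>P = 0\<close> c12 by simp
  then show c: "c = 0"
    by (rule affine_pos_imp_constant)
  show "2 * z t * z'' t + (z' t)\<^sup>2 = b\<^sup>2 / (a\<^sup>2 + b\<^sup>2)" if "t \<in> I" for t
  proof -
    have "a\<^sup>2 + b\<^sup>2 \<noteq> 0"
      using b by (simp add: sum_power2_eq_zero_iff)
    \<comment> \<open>With all three constants zero, \<open>A\<close> reduces to a multiple of
      \<open>z''\<close> and \<open>w\<close> to a multiple of \<open>z'\<close>; clearing the
      denominator \<open>b\<^sup>2\<close> gives the equation.\<close>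
    moreover have "2 * z t * ((1 + (a / b)\<^sup>2) * z'' t) = 1 - (z' t)\<^sup>2 - (a / b * z' t)\<^sup>2"
      using const[OF that] c c12 by (simp add: A_def w_def k_def)
    then have "(a\<^sup>2 + b\<^sup>2) * (2 * z t * z'' t + (z' t)\<^sup>2) = b\<^sup>2"
      using b by (simp add: power_divide power_mult_distrib field_simps)
    ultimately show ?thesis
      by (simp add: field_simps)
  qed
qed

theorem theorem11:
  fixes a b c c1 c2 :: real and z :: "real \<Rightarrow> real" and I :: "real set"
  assumes "b \<noteq> 0"
    and "open I" and "is_interval I" and "I \<noteq> {}"
    and "\<forall>t\<in>I. z differentiable (at t)"
    and "\<forall>t\<in>I. deriv z differentiable (at t)"
    and "continuous_on I (deriv (deriv z))"
  shows
    "(isotropic_singular_minimal_yz (parabolic_surface a b c c1 c2 z I \<inter> half_space_x) \<and>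
      (\<forall>t\<in>I. \<exists>\<theta>. parabolic_param a b c c1 c2 z t \<theta> \<in> half_space_x) \<longrightarrow>
        (a = 0 \<longrightarrow>
           c1 = 0 \<and>
           (\<exists>z1 z2. \<forall>t\<in>I. z t = - (c2 / (4 * b)) * t\<^sup>2 + z2 * ln t + z1)) \<and>
        (a \<noteq> 0 \<longrightarrow>
           a * c2 + 2 * b * c1 = 0 \<and>
           (\<exists>z1. \<forall>t\<in>I. z t = c1 / (2 * a) * t\<^sup>2 + z1))) \<and>
     (isotropic_singular_minimal_xy (parabolic_surface a b c c1 c2 z I) \<longrightarrow>
        c = 0 \<and> c1 = 0 \<and>
        (\<forall>t\<in>I. (2 * z t + b * c2 * t\<^sup>2) * deriv (deriv z) t + (deriv z t)\<^sup>2
                 - 2 * a * b * c2 / (a\<^sup>2 + b\<^sup>2) * t * deriv z t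
                 + 2 * b * c2 / (a\<^sup>2 + b\<^sup>2) * (z t + b * c2 * t\<^sup>2)
                 - b\<^sup>2 / (a\<^sup>2 + b\<^sup>2) = 0))"
proof -
  have z: "\<forall>t\<in>I. (z has_real_derivative deriv z t) (at t)"
    and z': "\<forall>t\<in>I. (deriv z has_real_derivative deriv (deriv z) t) (at t)"
    using assms(5,6) by (auto simp: DERIV_deriv_iff_real_differentiable)
  \<comment> \<open>Substituting c2 = 0 reduces the stated differential equation to the shorter one
    proved for the plane z = 0.\<close>
  show ?thesis
    using singular_minimal_yz_profile[OF assms(1-4) z z' assms(7), of a c c1 c2]
      singular_minimal_xy_profile[OF assms(1,2,4) z z' assms(7), of a c c1 c2]
    by auto
qed

end
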